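(* (ZFC) There exist a partition $\{A_n\}_{n<\omega}$ of $\omega_1$ and a family $\{B_\alpha\}_{\alpha<\omega_1}$ of countable sets of countable ordinals such that: (a) for every $\alpha<\omega_1$, $\max B_\alpha=\alpha$; (b) for all $\alpha,\beta<\omega_1$, if $\alpha\in B_\beta$ then $B_\alpha\subseteq B_\beta$; (c) for every limit ordinal $\lambda<\omega_1$ and every $\alpha$ with $\lambda\le\alpha<\omega_1$, $B_\alpha\cap\lambda\not\subseteq\gamma\cup B_{\beta_1}\cup\dots\cup B_{\beta_k}$ for any $\gamma<\lambda$, any $k<\omega$ and any $\beta_1,\dots,\beta_k<\alpha$; (d) for every $\alpha<\omega_1$ and every $n<\omega$, the set $B_\alpha\cap A_n$ is finite. *)

theory Defs
  imports "HOL-Library.Countable_Set_Type" "HOL-Library.Disjoint_Sets"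
begin

(* In HOL the ordinal omega_1 is the order type of cardSuc natLeq, the cardinal
   successor of the well-order natLeq of the naturals.  The elements of the type
   are the countable ordinals, and an ordinal gamma regarded as the set of its
   predecessors is {..<gamma}. *)
typedef omega1 = "Field (cardSuc natLeq)"
proof -
  have "Field (cardSuc natLeq) \<noteq> {}"
    using cardSuc_finite[OF natLeq_Card_order] by (auto simp: Field_natLeq)
  thus ?thesis by blast
qed

lemma cardSuc_natLeq_well_order: "well_order_on (Field (cardSuc natLeq)) (cardSuc natLeq)"
  using cardSuc_Card_order[OF natLeq_Card_order] by (simp add: card_order_on_def)

instantiation omega1 :: wellorder
begin

definition less_eq_omega1 :: "omega1 \<Rightarrow> omega1 \<Rightarrow> bool" where
  "x \<le> y \<longleftrightarrow> (Rep_omega1 x, Rep_omega1 y) \<in> cardSuc natLeq"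

definition less_omega1 :: "omega1 \<Rightarrow> omega1 \<Rightarrow> bool" where
  "x < y \<longleftrightarrow> x \<le> y \<and> x \<noteq> (y :: omega1)"

instance
proof -
  let ?r = "cardSuc natLeq"
  have lin: "Linear_order ?r" and wf: "wf (?r - Id)"
    using cardSuc_natLeq_well_order by (auto simp: well_order_on_def)
  have tot: "total_on (Field ?r) ?r" and anti: "antisym ?r" and tr: "trans ?r"
    and refl: "refl_on (Field ?r) ?r"
    using lin by (auto simp: linear_order_on_def partial_order_on_def preorder_on_def)
  have R: "Rep_omega1 x \<in> Field ?r" for x by (rule Rep_omega1)
  have refl': "x \<le> x" for x :: omega1
    using refl R by (auto simp: less_eq_omega1_def refl_on_def)
  have anti': "x = y" if "x \<le> y" "y \<le> x" for x y :: omega1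
    using that antisymD[OF anti] Rep_omega1_inject unfolding less_eq_omega1_def by blast
  have tr': "x \<le> z" if "x \<le> y" "y \<le> z" for x y z :: omega1
    using that transD[OF tr] by (auto simp: less_eq_omega1_def)
  have tot': "x \<le> y \<or> y \<le> x" for x y :: omega1
    using tot R refl' unfolding less_eq_omega1_def total_on_def
    by (metis Rep_omega1_inject)
  have least: "P a" if "\<And>x. (\<And>y. y < x \<Longrightarrow> P y) \<Longrightarrow> P x" for P and a :: omega1
  proof -
    have "wf {(x :: omega1, y). x < y}"
      by (rule wf_subset[OF wf_inv_image[OF wf, of Rep_omega1]])
        (auto simp: inv_image_def less_omega1_def less_eq_omega1_def Rep_omega1_inject)
    thus ?thesis using that by (induction a rule: wf_induct_rule) auto
  qed
  show "OFCLASS(omega1, wellorder_class)"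
  proof (intro_classes, goal_cases)
    case (6 P a)
    thus ?case using least by blast
  qed (use refl' anti' tr' tot' in \<open>auto simp: less_omega1_def\<close>)
qed

end

lemma uncountable_omega1:
  includes cardinal_syntax
  shows "\<not> countable (UNIV :: omega1 set)"
proof
  let ?r = "cardSuc natLeq"
  assume "countable (UNIV :: omega1 set)"
  hence "countable (Field ?r)"
    by (metis countable_image type_definition.Rep_range type_definition_omega1)
  hence "|Field ?r| \<le>o natLeq" by (simp add: countable_card_le_natLeq)
  moreover have "|Field ?r| =o ?r"
    by (rule card_of_Field_ordIso[OF cardSuc_Card_order[OF natLeq_Card_order]])
  ultimately have "?r \<le>o natLeq"
    using ordIso_ordLeq_trans ordIso_symmetric by blast
  thus False
    using cardSuc_greater[OF natLeq_Card_order] not_ordLess_ordLeq by blast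
qed

lemma countable_lessThan_omega1:
  includes cardinal_syntax
  shows "countable {..<a :: omega1}"
proof -
  let ?r = "cardSuc natLeq"
  have C: "Card_order ?r" by (rule cardSuc_Card_order[OF natLeq_Card_order])
  have "|underS ?r (Rep_omega1 a)| <o ?r"
    by (rule card_of_underS[OF C Rep_omega1])
  hence "|underS ?r (Rep_omega1 a)| \<le>o natLeq"
    using cardSuc_ordLess_ordLeq[OF natLeq_Card_order card_of_Card_order]
      cardSuc_ordLeq_ordLess[OF natLeq_Card_order card_of_Card_order] by blast
  hence "countable (underS ?r (Rep_omega1 a))" by (simp add: countable_card_le_natLeq)
  moreover have "Rep_omega1 ` {..<a} \<subseteq> underS ?r (Rep_omega1 a)"
    by (auto simp: underS_def less_omega1_def less_eq_omega1_def Rep_omega1_inject)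
  ultimately have "countable (Rep_omega1 ` {..<a})" by (rule countable_subset[rotated])
  thus ?thesis
    by (rule countable_image_inj_on) (simp add: inj_on_def Rep_omega1_inject)
qed

(* 0 is not a limit ordinal. *)
definition limit_ordinal :: "'a :: wellorder \<Rightarrow> bool" where
  "limit_ordinal \<delta> \<longleftrightarrow> (\<exists>\<xi>. \<xi> < \<delta>) \<and> (\<forall>\<xi><\<delta>. \<exists>\<eta>. \<xi> < \<eta> \<and> \<eta> < \<delta>)"

end

theory Submission
  imports Defs
begin

text \<open>
  Write every countable ordinal as \<open>\<mu> + k\<close> with \<open>\<mu>\<close> zero or a limit and \<open>k < \<omega>\<close>, let
  \<open>f (\<mu> + k) = k\<close> and let \<open>A\<^sub>n\<close> be the fibre of \<open>f\<close> over \<open>n\<close>.  The sets \<open>B\<^sub>\<alpha>\<close> are built by recursion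
  such that \<open>f \<ge> f \<alpha>\<close> on \<open>B\<^sub>\<alpha>\<close>, and such that, for every limit \<open>\<delta> \<le> \<alpha>\<close>, finitely many of the sets
  built so far never cover a final segment of \<open>{\<xi> < \<delta>. f \<xi> > n}\<close>.  At stage \<open>\<alpha>\<close> there are
  only countably many requirements \<open>(\<delta>, \<gamma>, F, n)\<close>.  For the \<open>i\<close>-th of them one picks a witness
  \<open>\<xi>\<^sub>i\<close> to be put into \<open>B\<^sub>\<alpha>\<close> and a witness \<open>\<eta>\<^sub>i\<close> to be kept outside, and then
  \<open>B\<^sub>\<alpha> = {\<alpha>} \<union> \<Union>\<^sub>i B\<^bsub>\<xi>\<^sub>i\<^esub>\<close>.  Choosing \<open>f \<xi>\<^sub>i > f \<eta>\<^sub>j\<close> for \<open>j < i\<close> keeps \<open>\<eta>\<^sub>j\<close> out of the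
  later \<open>B\<^bsub>\<xi>\<^sub>i\<^esub>\<close>, and choosing \<open>f \<xi>\<^sub>i > i\<close> makes \<open>f\<close> finite-to-one on the union.
\<close>

definition steep :: "('a::wellorder \<Rightarrow> nat) \<Rightarrow> bool" where
  "steep f \<longleftrightarrow> (\<forall>\<delta> \<gamma> n. limit_ordinal \<delta> \<and> \<gamma> < \<delta> \<longrightarrow> (\<exists>\<xi>. \<gamma> \<le> \<xi> \<and> \<xi> < \<delta> \<and> n < f \<xi>))"

lemma steepD:
  assumes "steep f" "limit_ordinal \<delta>" "\<gamma> < \<delta>"
  obtains \<xi> where "\<gamma> \<le> \<xi>" "\<xi> < \<delta>" "n < f \<xi>"
  using assms unfolding steep_def by blast

lemma ex_omega1_greater: "\<exists>\<beta>. \<alpha> < (\<beta> :: omega1)"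
proof (rule ccontr)
  assume "\<not> ?thesis"
  hence "UNIV = insert \<alpha> {..<\<alpha>}"
    by (auto simp: not_less order.order_iff_strict)
  thus False
    using uncountable_omega1 countable_lessThan_omega1[of \<alpha>] by (metis countable_insert)
qed

definition next_omega1 :: "omega1 \<Rightarrow> omega1" where
  "next_omega1 \<alpha> = (LEAST \<beta>. \<alpha> < \<beta>)"

lemma next_omega1_greater: "\<alpha> < next_omega1 \<alpha>"
  unfolding next_omega1_def using ex_omega1_greater by (rule LeastI_ex)

lemma next_omega1_le: "\<alpha> < \<beta> \<Longrightarrow> next_omega1 \<alpha> \<le> \<beta>"
  unfolding next_omega1_def by (rule Least_le)

lemma inj_next_omega1: "inj next_omega1"
proof (rule injI)
  fix \<alpha> \<beta> assume "next_omega1 \<alpha> = next_omega1 \<beta>"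
  thus "\<alpha> = \<beta>"
    by (metis leD linorder_neqE next_omega1_greater next_omega1_le)
qed

text \<open>\<open>f\<close> counts the successor steps since the last zero or limit. It grows by
  one at each successor, and iterated successors stay below a limit, so n + 1 steps from \<gamma>
  push \<open>f\<close> past n. The iterates of the least element realise every value.\<close>

lemma steep_surj_omega1: "\<exists>f :: omega1 \<Rightarrow> nat. steep f \<and> surj f"
proof -
  \<comment> \<open>On successors \<open>inv next_omega1\<close> is the predecessor, so only a value
    below \<alpha> is read; zero and limits restart at 0.\<close>
  define P where "P f \<alpha> r \<longleftrightarrow> r = (if \<alpha> \<in> range next_omega1 then Suc (f (inv next_omega1 \<alpha>)) else 0)"
    for f :: "omega1 \<Rightarrow> nat" and \<alpha> r
  have "\<exists>f. \<forall>\<alpha>. P f \<alpha> (f \<alpha>)"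
  proof (rule dependent_wellorder_choice)
    show "P f \<alpha> r = P g \<alpha> r" if "\<And>\<beta>. \<beta> < \<alpha> \<Longrightarrow> f \<beta> = g \<beta>" for r f g \<alpha>
      using that next_omega1_greater by (auto simp: P_def inv_f_f[OF inj_next_omega1])
  qed (simp add: P_def)
  then obtain f where f: "\<And>\<alpha>. P f \<alpha> (f \<alpha>)" by blast
  have f_next: "f (next_omega1 \<alpha>) = Suc (f \<alpha>)" for \<alpha>
    using f[of "next_omega1 \<alpha>"] by (simp add: P_def inv_f_f[OF inj_next_omega1])
  hence f_iter: "f ((next_omega1 ^^ k) \<alpha>) = f \<alpha> + k" for k \<alpha>
    by (induction k) auto
  have "(LEAST \<alpha>. True) \<notin> range next_omega1"
    by (metis (full_types) Least_le imageE leD next_omega1_greater)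
  hence f_zero: "f (LEAST \<alpha>. True) = 0"
    using f[of "LEAST \<alpha>. True"] by (simp add: P_def)
  have "surj f"
    using f_iter[of _ "LEAST \<alpha>. True"] by (intro surjI) (simp add: f_zero)
  moreover have "steep f"
    unfolding steep_def
  proof (intro allI impI, elim conjE)
    fix \<delta> \<gamma> :: omega1 and n assume \<delta>: "limit_ordinal \<delta>" and "\<gamma> < \<delta>"
    have "\<gamma> \<le> (next_omega1 ^^ k) \<gamma> \<and> (next_omega1 ^^ k) \<gamma> < \<delta>" for k
    proof (induction k)
      case (Suc k)
      then obtain \<eta> where "(next_omega1 ^^ k) \<gamma> < \<eta>" "\<eta> < \<delta>"
        using \<delta> unfolding limit_ordinal_def by blast
      thus ?case
        using Suc next_omega1_greater[of "(next_omega1 ^^ k) \<gamma>"] next_omega1_le[of "(next_omega1 ^^ k) \<gamma>" \<eta>]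
        by auto
    qed (use \<open>\<gamma> < \<delta>\<close> in simp)
    thus "\<exists>\<xi>. \<gamma> \<le> \<xi> \<and> \<xi> < \<delta> \<and> n < f \<xi>"
      by (intro exI[of _ "(next_omega1 ^^ Suc n) \<gamma>"]) (simp only: f_iter, simp)
  qed
  ultimately show ?thesis by blast
qed

text \<open>\<open>S\<close> is a candidate for \<open>B \<alpha>\<close>. In the last clause the
  first conjunct yields (c), and the second is the induction hypothesis that leaves room for the
  witnesses of later stages. The lower bound \<open>f \<alpha>\<close> on \<open>S\<close> lets
  later stages exclude a point by comparing values of \<open>f\<close>.\<close>

definition good_step :: "('a::wellorder \<Rightarrow> nat) \<Rightarrow> ('a \<Rightarrow> 'a set) \<Rightarrow> 'a \<Rightarrow> 'a set \<Rightarrow> bool" where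
  "good_step f B \<alpha> S \<longleftrightarrow>
    \<alpha> \<in> S \<and> S \<subseteq> {..\<alpha>} \<and> (\<forall>\<beta>\<in>S. \<beta> < \<alpha> \<longrightarrow> B \<beta> \<subseteq> S) \<and>
    (\<forall>\<xi>\<in>S. f \<alpha> \<le> f \<xi>) \<and> (\<forall>n. finite (S \<inter> f -` {n})) \<and>
    (\<forall>\<delta> \<gamma> F n. limit_ordinal \<delta> \<and> \<delta> \<le> \<alpha> \<and> \<gamma> < \<delta> \<and> finite F \<and> F \<subseteq> {..<\<alpha>} \<longrightarrow>
      (\<exists>\<xi>\<in>{\<gamma>..<\<delta>} - \<Union> (B ` F). \<xi> \<in> S) \<and>
      (\<exists>\<xi>\<in>{\<gamma>..<\<delta>} - \<Union> (B ` F). \<xi> \<notin> S \<and> n < f \<xi>))"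

text \<open>The congruence required for choosing \<open>B\<close> by well-founded recursion.\<close>

lemma good_step_cong:
  assumes "\<And>\<beta>. \<beta> < \<alpha> \<Longrightarrow> B \<beta> = C \<beta>"
  shows "good_step f B \<alpha> S = good_step f C \<alpha> S"
proof -
  have "\<Union> (B ` F) = \<Union> (C ` F)" if "F \<subseteq> {..<\<alpha>}" for F
    using assms that by (intro SUP_cong) auto
  thus ?thesis
    unfolding good_step_def using assms by (simp cong: conj_cong imp_cong)
qed

text \<open>Let \<beta> be the largest element of \<open>F\<close>. If \<delta> \<le> \<beta>, the
  last conjunct of \<open>good_step\<close> at \<beta>, applied to \<open>F - {\<beta>}\<close>,
  gives the point. If \<beta> < \<delta>, all \<open>B \<zeta>\<close> with \<zeta> in
  \<open>F\<close> lie in \<open>{..\<beta>}\<close>, and steepness gives a point between \<beta>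
  and \<delta>.\<close>

lemma good_step_avoid:
  assumes "steep f" and B: "\<And>\<beta>. \<beta> < \<alpha> \<Longrightarrow> good_step f B \<beta> (B \<beta>)"
    and \<delta>: "limit_ordinal \<delta>" "\<delta> \<le> \<alpha>" "\<gamma> < \<delta>" and F: "finite F" "F \<subseteq> {..<\<alpha>}"
  obtains \<xi> where "\<xi> \<in> {\<gamma>..<\<delta>} - \<Union> (B ` F)" "n < f \<xi>"
proof (cases "F = {}")
  case True
  thus ?thesis
    using that steepD[OF assms(1) \<delta>(1,3), of n] by auto
next
  case False
  define \<beta> where "\<beta> = Max F"
  have \<beta>: "\<beta> \<in> F" and le: "\<And>\<zeta>. \<zeta> \<in> F \<Longrightarrow> \<zeta> \<le> \<beta>"
    using F False by (auto simp: \<beta>_def)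
  show ?thesis
  proof (cases "\<delta> \<le> \<beta>")
    case True
    have "good_step f B \<beta> (B \<beta>)" "F - {\<beta>} \<subseteq> {..<\<beta>}"
      using B \<beta> F le by (auto simp: order.order_iff_strict)
    then obtain \<xi> where "\<xi> \<in> {\<gamma>..<\<delta>} - \<Union> (B ` (F - {\<beta>}))" "\<xi> \<notin> B \<beta>" "n < f \<xi>"
      unfolding good_step_def using \<delta> True F(1) by (meson finite_Diff)
    thus ?thesis
      by (intro that[of \<xi>]) auto
  next
    case False
    then obtain \<eta> where "\<beta> < \<eta>" "\<eta> < \<delta>"
      using \<delta> unfolding limit_ordinal_def by (meson not_le)
    then obtain \<xi> where \<xi>: "max \<gamma> \<eta> \<le> \<xi>" "\<xi> < \<delta>" "n < f \<xi>"
      using steepD[OF assms(1) \<delta>(1), of "max \<gamma> \<eta>" n] \<delta>(3) by auto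
    have "\<xi> \<notin> B \<zeta>" if "\<zeta> \<in> F" for \<zeta>
    proof -
      have "B \<zeta> \<subseteq> {..\<zeta>}"
        using B that F unfolding good_step_def by blast
      thus ?thesis
        using le[OF that] \<xi>(1) \<open>\<beta> < \<eta>\<close> by auto
    qed
    thus ?thesis
      using \<xi> by (intro that[of \<xi>]) auto
  qed
qed

lemma good_step_exists:
  assumes f: "steep f" and B: "\<And>\<beta>. \<beta> < \<alpha> \<Longrightarrow> good_step f B \<beta> (B \<beta>)"
    and "countable {..<\<alpha>}"
  shows "\<exists>S. good_step f B \<alpha> S"
proof -
  have B_self: "\<beta> \<in> B \<beta>" and B_le: "B \<beta> \<subseteq> {..\<beta>}"
    and B_trans: "\<And>\<zeta>. \<zeta> \<in> B \<beta> \<Longrightarrow> B \<zeta> \<subseteq> B \<beta>"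
    and B_f: "\<And>\<xi>. \<xi> \<in> B \<beta> \<Longrightarrow> f \<beta> \<le> f \<xi>" and B_fin: "\<And>n. finite (B \<beta> \<inter> f -` {n})"
    if "\<beta> < \<alpha>" for \<beta>
    using B[OF that] unfolding good_step_def by (auto simp: subset_iff order.order_iff_strict)
  define T where "T = {(\<delta>, \<gamma>, F, n :: nat). limit_ordinal \<delta> \<and> \<delta> \<le> \<alpha> \<and> \<gamma> < \<delta> \<and> finite F \<and> F \<subseteq> {..<\<alpha>}}"
  have T_count: "countable T"
  proof (rule countable_subset)
    have "countable {..\<alpha>}"
      using assms(3) by (simp add: lessThan_Suc_atMost ivl_disj_un_singleton(2)[symmetric])
    moreover have "countable {F. finite F \<and> F \<subseteq> {..<\<alpha>}}"
      using assms(3) by (rule countable_Collect_finite_subset)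
    ultimately show "countable ({..\<alpha>} \<times> {..\<alpha>} \<times> {F. finite F \<and> F \<subseteq> {..<\<alpha>}} \<times> (UNIV :: nat set))"
      by (intro countable_SIGMA) auto
  qed (auto simp: T_def)
  show ?thesis
  proof (cases "T = {}")
    \<comment> \<open>There is no limit \<le> \<alpha>, so the last clause of
      \<open>good_step\<close> is vacuous.\<close>
    case True
    hence "good_step f B \<alpha> {\<alpha>}"
      unfolding good_step_def T_def by fastforce
    thus ?thesis ..
  next
    case False
    define e where "e = from_nat_into T"
    have eT: "e i \<in> T" for i
      unfolding e_def using False by (rule from_nat_into)
    have e_surj: "\<exists>i. e i = t" if "t \<in> T" for t
      unfolding e_def using from_nat_into_surj[OF T_count that] .
    \<comment> \<open>\<open>p\<close> is the i-th pair of witnesses and \<open>g\<close> supplies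
      the earlier ones. The point \<eta> avoids the sets of index \<le> i outright; later sets are
      kept away from it by the values of \<open>f\<close>.\<close>
    define P where "P g i p \<longleftrightarrow> (case e i of (\<delta>, \<gamma>, F, n) \<Rightarrow> case p of (\<xi>, \<eta>) \<Rightarrow>
        \<xi> \<in> {\<gamma>..<\<delta>} - \<Union> (B ` F) \<and> f \<alpha> \<le> f \<xi> \<and> i < f \<xi> \<and> (\<forall>j<i. f (snd (g j)) < f \<xi>) \<and>
        \<eta> \<in> {\<gamma>..<\<delta>} - \<Union> (B ` F) \<and> \<eta> \<notin> B \<xi> \<and> (\<forall>j<i. \<eta> \<notin> B (fst (g j))) \<and> n < f \<eta>)"
      for g :: "nat \<Rightarrow> 'a \<times> 'a" and i p
    have "\<exists>g. \<forall>i. P g i (g i)"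
    proof (rule dependent_wellorder_choice)
      show "P g i p = P h i p" if "\<And>j. j < i \<Longrightarrow> g j = h j" for p g h i
        using that by (simp add: P_def cong: conj_cong)
    next
      fix i g assume IH: "\<And>j. j < i \<Longrightarrow> P g j (g j)"
      obtain \<delta> \<gamma> F n where e: "e i = (\<delta>, \<gamma>, F, n)" by (cases "e i")
      hence \<delta>: "limit_ordinal \<delta>" "\<delta> \<le> \<alpha>" "\<gamma> < \<delta>" and F: "finite F" "F \<subseteq> {..<\<alpha>}"
        using eT[of i] by (auto simp: T_def)
      have "fst (g j) < \<alpha>" if "j < i" for j
        using IH[OF that] eT[of j] by (auto simp: P_def T_def)
      hence G: "fst ` g ` {..<i} \<subseteq> {..<\<alpha>}" by auto
      \<comment> \<open>All lower bounds on \<open>f \<xi>\<close> are merged into one number, so a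
        single avoidance step yields \<xi>.\<close>
      define N where "N = Max (insert (f \<alpha>) (insert i ((\<lambda>j. f (snd (g j))) ` {..<i})))"
      obtain \<xi> where \<xi>: "\<xi> \<in> {\<gamma>..<\<delta>} - \<Union> (B ` F)" "N < f \<xi>"
        using good_step_avoid[OF f B \<delta> F] by blast
      \<comment> \<open>Adding \<xi> and the earlier \<xi>_j to \<open>F\<close> makes \<eta> avoid
        their sets too; this is allowed since each lies below a limit \<le> \<alpha>.\<close>
      have F': "finite (F \<union> insert \<xi> (fst ` g ` {..<i}))" "F \<union> insert \<xi> (fst ` g ` {..<i}) \<subseteq> {..<\<alpha>}"
        using F G \<xi> \<delta> by auto
      obtain \<eta> where \<eta>: "\<eta> \<in> {\<gamma>..<\<delta>} - \<Union> (B ` (F \<union> insert \<xi> (fst ` g ` {..<i})))" "n < f \<eta>"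
        using good_step_avoid[OF f B \<delta> F'] by blast
      have "x \<le> N" if "x \<in> insert (f \<alpha>) (insert i ((\<lambda>j. f (snd (g j))) ` {..<i}))" for x
        unfolding N_def using that by (intro Max_ge) auto
      hence "f \<alpha> \<le> f \<xi>" "i < f \<xi>" "\<forall>j<i. f (snd (g j)) < f \<xi>"
        using \<xi>(2) by (auto intro: less_imp_le le_less_trans[of _ N "f \<xi>"])
      hence "P g i (\<xi>, \<eta>)"
        unfolding P_def e using \<xi> \<eta> by auto
      thus "\<exists>p. P g i p" ..
    qed
    then obtain g where g: "\<And>i. P g i (g i)" by blast
    define x y where "x i = fst (g i)" and "y i = snd (g i)" for i
    have xy: "x i \<in> {\<gamma>..<\<delta>} - \<Union> (B ` F)" "f \<alpha> \<le> f (x i)" "i < f (x i)"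
      "\<And>j. j < i \<Longrightarrow> f (y j) < f (x i)"
      "y i \<in> {\<gamma>..<\<delta>} - \<Union> (B ` F)" "\<And>j. j \<le> i \<Longrightarrow> y i \<notin> B (x j)" "n < f (y i)"
      if "e i = (\<delta>, \<gamma>, F, n)" for i \<delta> \<gamma> F n
      using g[of i] that by (auto simp: P_def x_def y_def order.order_iff_strict split: prod.splits)
    have less: "x i < \<alpha>" "y i < \<alpha>" for i
      using xy(1,5)[of i] eT[of i] by (auto simp: T_def)
    have x_f: "f \<alpha> \<le> f (x i)" "i < f (x i)" for i
      using xy(2,3)[of i] by (cases "e i"; blast)+
    \<comment> \<open>For j > i, \<open>f\<close> is at least \<open>f (x j)\<close> on
      \<open>B (x j)\<close>, which exceeds \<open>f (y i)\<close>.\<close>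
    have yx: "y i \<notin> B (x j)" for i j
    proof (cases "j \<le> i")
      case True
      thus ?thesis using xy(6)[of i] by (cases "e i") blast
    next
      case False
      hence "f (y i) < f (x j)" using xy(4)[of j] by (cases "e j") auto
      thus ?thesis using B_f[OF less(1)[of j], of "y i"] by auto
    qed
    define S where "S = insert \<alpha> (\<Union>i. B (x i))"
    have f_B_x: "i < f \<xi>" if "\<xi> \<in> B (x i)" for i \<xi>
      using x_f(2) B_f[OF less(1) that] by (rule less_le_trans)
    \<comment> \<open>Apart from \<alpha>, a point with value n can come only from
      \<open>B (x i)\<close> with i < n.\<close>
    have "finite (S \<inter> f -` {n})" for n
    proof (rule finite_subset)
      show "S \<inter> f -` {n} \<subseteq> insert \<alpha> (\<Union>i\<in>{..<n}. B (x i) \<inter> f -` {n})"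
        using f_B_x by (auto simp: S_def)
      show "finite (insert \<alpha> (\<Union>i\<in>{..<n}. B (x i) \<inter> f -` {n}))"
        by (intro finite.insertI finite_UN_I finite_lessThan B_fin[OF less(1)])
    qed
    moreover have "S \<subseteq> {..\<alpha>}"
      unfolding S_def using order.trans[OF B_le[OF less(1)]] less(1) by (simp add: UN_subset_iff less_imp_le)
    moreover have "\<forall>\<beta>\<in>S. \<beta> < \<alpha> \<longrightarrow> B \<beta> \<subseteq> S"
      unfolding S_def using B_trans[OF less(1)] by blast
    moreover have "\<forall>\<xi>\<in>S. f \<alpha> \<le> f \<xi>"
      unfolding S_def using le_trans[OF x_f(1) B_f[OF less(1)]] by auto
    moreover have "(\<exists>\<xi>\<in>{\<gamma>..<\<delta>} - \<Union> (B ` F). \<xi> \<in> S) \<and>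
        (\<exists>\<xi>\<in>{\<gamma>..<\<delta>} - \<Union> (B ` F). \<xi> \<notin> S \<and> n < f \<xi>)"
      if req: "limit_ordinal \<delta> \<and> \<delta> \<le> \<alpha> \<and> \<gamma> < \<delta> \<and> finite F \<and> F \<subseteq> {..<\<alpha>}" for \<delta> \<gamma> F n
    proof -
      obtain i where i: "e i = (\<delta>, \<gamma>, F, n)"
        using e_surj[of "(\<delta>, \<gamma>, F, n)"] req by (auto simp: T_def)
      have "x i \<in> S"
        unfolding S_def using B_self[OF less(1)] by blast
      moreover have "y i \<notin> S"
        unfolding S_def using yx less(2)[of i] by auto
      ultimately show ?thesis
        using xy(1,5,7)[OF i] by blast
    qed
    ultimately have "good_step f B \<alpha> S"
      unfolding good_step_def by (simp add: S_def)
    thus ?thesis ..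
  qed
qed

theorem theorem3p1:
  shows "\<exists>(A :: nat \<Rightarrow> omega1 set) (B :: omega1 \<Rightarrow> omega1 set).
    ((\<forall>n. A n \<noteq> {}) \<and> disjoint_family A \<and> (\<Union>n. A n) = UNIV) \<and>
    (\<forall>\<alpha>. countable (B \<alpha>)) \<and>
    (\<forall>\<alpha>. \<alpha> \<in> B \<alpha> \<and> (\<forall>\<xi>\<in>B \<alpha>. \<xi> \<le> \<alpha>)) \<and>
    (\<forall>\<alpha> \<beta>. \<alpha> \<in> B \<beta> \<longrightarrow> B \<alpha> \<subseteq> B \<beta>) \<and>
    (\<forall>\<delta> \<alpha>. limit_ordinal \<delta> \<and> \<delta> \<le> \<alpha> \<longrightarrow>
      (\<forall>\<gamma><\<delta>. \<forall>(k :: nat) (\<beta> :: nat \<Rightarrow> omega1). (\<forall>i\<in>{1..k}. \<beta> i < \<alpha>) \<longrightarrow>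
        \<not> B \<alpha> \<inter> {..<\<delta>} \<subseteq> {..<\<gamma>} \<union> (\<Union>i\<in>{1..k}. B (\<beta> i)))) \<and>
    (\<forall>\<alpha> n. finite (B \<alpha> \<inter> A n))"
proof -
  obtain f :: "omega1 \<Rightarrow> nat" where f: "steep f" "surj f"
    using steep_surj_omega1 by blast
  have "\<exists>B. \<forall>\<alpha>. good_step f B \<alpha> (B \<alpha>)"
    using good_step_cong good_step_exists[OF f(1) _ countable_lessThan_omega1]
    by (rule dependent_wellorder_choice)
  then obtain B where B: "\<And>\<alpha>. good_step f B \<alpha> (B \<alpha>)" by blast
  define A where "A n = f -` {n}" for n
  have "A n \<noteq> {}" for n
    using surjD[OF f(2), of n] by (auto simp: A_def)
  moreover have "disjoint_family A" "(\<Union>n. A n) = UNIV"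
    by (auto simp: A_def disjoint_family_on_def)
  moreover have max: "\<alpha> \<in> B \<alpha>" "\<xi> \<in> B \<alpha> \<Longrightarrow> \<xi> \<le> \<alpha>" for \<alpha> \<xi>
    using B[of \<alpha>] by (auto simp: good_step_def)
  moreover have "countable (B \<alpha>)" for \<alpha>
  proof (rule countable_subset)
    show "B \<alpha> \<subseteq> insert \<alpha> {..<\<alpha>}"
      using max(2) by (auto simp: order.order_iff_strict)
  qed (simp add: countable_lessThan_omega1)
  moreover have "B \<alpha> \<subseteq> B \<beta>" if "\<alpha> \<in> B \<beta>" for \<alpha> \<beta>
    using B[of \<beta>] that max(2)[OF that] unfolding good_step_def
    by (metis order.order_iff_strict order.refl)
  moreover have "\<not> B \<alpha> \<inter> {..<\<delta>} \<subseteq> {..<\<gamma>} \<union> (\<Union>i\<in>{1..k}. B (\<beta> i))"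
    if \<delta>: "limit_ordinal \<delta> \<and> \<delta> \<le> \<alpha>" "\<gamma> < \<delta>" and \<beta>: "\<forall>i\<in>{1..k}. \<beta> i < \<alpha>" for \<delta> \<alpha> \<gamma> and k :: nat and \<beta>
  proof -
    have "finite (\<beta> ` {1..k})" "\<beta> ` {1..k} \<subseteq> {..<\<alpha>}"
      using \<beta> by auto
    \<comment> \<open>The requirement with \<open>F\<close> the set of the \<beta>_i gives a point
      of \<open>B \<alpha>\<close> in \<delta> that escapes the proposed cover.\<close>
    then obtain \<xi> where "\<xi> \<in> {\<gamma>..<\<delta>} - \<Union> (B ` \<beta> ` {1..k})" "\<xi> \<in> B \<alpha>"
      using B[of \<alpha>] \<delta> unfolding good_step_def by meson
    thus ?thesis by auto
  qed
  moreover have "finite (B \<alpha> \<inter> A n)" for \<alpha> n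
    using B[of \<alpha>] by (simp add: good_step_def A_def)
  ultimately show ?thesis
    by (intro exI[of _ A] exI[of _ B]) blast
qed

end
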